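(* Let $\beta\ge 1$ be any constant. Then any one-pass streaming algorithm which $\frac{\beta}{32}$-approximates the size of a minimum dominating set on $n$-vertex graphs of arboricity $\beta+2$ requires $\Omega(n)$ space.
   Context: A dominating set of a graph $G=(V,E)$ is a set $S\subseteq V$ such that every vertex of $V\setminus S$ has a neighbor in $S$. The arboricity of a graph is the minimum number of forests into which its edge set can be partitioned. An algorithm $\alpha$-approximates the size of a minimum dominating set if it outputs an estimate within a factor $\alpha$ of that size. Streaming model: the vertex set is fixed and edges arrive one by one in an insertion-only stream. The lower bound applies also to randomized algorithms required to succeed with probability at least $3/4$. *)

theory Defs
  imports "HOL-Probability.Probability" "HOL-Library.Landau_Symbols"
begin

text \<open>Graphs are simple and undirected: a vertex set \<open>V\<close> together with a set \<open>E\<close> of two-element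
  subsets of \<open>V\<close>.\<close>

definition simple_graph :: "'a set \<Rightarrow> 'a set set \<Rightarrow> bool" where
  "simple_graph V E \<longleftrightarrow> finite V \<and> (\<forall>e\<in>E. e \<subseteq> V \<and> card e = 2)"

definition dominating_set :: "'a set \<Rightarrow> 'a set set \<Rightarrow> 'a set \<Rightarrow> bool" where
  "dominating_set V E S \<longleftrightarrow> S \<subseteq> V \<and> (\<forall>v\<in>V - S. \<exists>u\<in>S. {u, v} \<in> E)"

definition domination_number :: "'a set \<Rightarrow> 'a set set \<Rightarrow> nat" where
  "domination_number V E = Min {card S | S. dominating_set V E S}"

definition is_cycle :: "'a set set \<Rightarrow> 'a list \<Rightarrow> bool" where
  "is_cycle E vs \<longleftrightarrow> 3 \<le> length vs \<and> distinct vs \<and>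
     (\<forall>i<length vs. {vs ! i, vs ! (Suc i mod length vs)} \<in> E)"

definition forest :: "'a set set \<Rightarrow> bool" where
  "forest F \<longleftrightarrow> (\<nexists>vs. is_cycle F vs)"

definition arboricity :: "'a set set \<Rightarrow> nat" where
  "arboricity E =
     (LEAST k. \<exists>P. partition_on E P \<and> finite P \<and> card P = k \<and> (\<forall>F\<in>P. forest F))"

text \<open>A one-pass randomized streaming algorithm for a fixed vertex set of natural numbers. The
  memory content is a bit string. The algorithm may use both fresh coin flips in every step
  and a random seed that is drawn once, can be re-read at any time and is not charged as memory.
  Deterministic algorithms are the case in which all distributions are point masses.\<close>

record 'r streaming_algorithm =
  seed :: "'r pmf"
  init_memory :: "'r \<Rightarrow> bool list pmf"
  process_edge :: "'r \<Rightarrow> nat set \<Rightarrow> bool list \<Rightarrow> bool list pmf"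
  estimate :: "'r \<Rightarrow> bool list \<Rightarrow> real pmf"

definition memory_after ::
  "'r streaming_algorithm \<Rightarrow> 'r \<Rightarrow> nat set list \<Rightarrow> bool list pmf" where
  "memory_after A r es =
     fold (\<lambda>e p. bind_pmf p (process_edge A r e)) es (init_memory A r)"

definition output_distribution ::
  "'r streaming_algorithm \<Rightarrow> nat set list \<Rightarrow> real pmf" where
  "output_distribution A es =
     bind_pmf (seed A) (\<lambda>r. bind_pmf (memory_after A r es) (estimate A r))"

text \<open>The insertion-only streams of the graphs on the vertex set \<open>{..<n}\<close> with arboricity
  exactly \<open>k\<close>: the edges arrive in arbitrary order, each of them once.\<close>

definition graph_stream :: "nat \<Rightarrow> nat \<Rightarrow> nat set list \<Rightarrow> bool" where
  "graph_stream n k es \<longleftrightarrow>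
     distinct es \<and> simple_graph {..<n} (set es) \<and> arboricity (set es) = k"

definition within_factor :: "real \<Rightarrow> real \<Rightarrow> real \<Rightarrow> bool" where
  "within_factor \<alpha> x y \<longleftrightarrow> x / \<alpha> \<le> y \<and> y \<le> \<alpha> * x"

definition approximates_domination_number ::
  "real \<Rightarrow> nat \<Rightarrow> nat \<Rightarrow> 'r streaming_algorithm \<Rightarrow> bool" where
  "approximates_domination_number \<alpha> n k A \<longleftrightarrow>
     (\<forall>es. graph_stream n k es \<longrightarrow>
        measure_pmf.prob (output_distribution A es)
          {y. within_factor \<alpha> (real (domination_number {..<n} (set es))) y} \<ge> 3 / 4)"

text \<open>At most \<open>s\<close> bits are stored at any time, in the worst case over the admissible streams
  and over all random choices.\<close>

definition uses_space :: "nat \<Rightarrow> nat \<Rightarrow> 'r streaming_algorithm \<Rightarrow> nat \<Rightarrow> bool" where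
  "uses_space n k A s \<longleftrightarrow>
     (\<forall>es. graph_stream n k es \<longrightarrow>
        (\<forall>i\<le>length es. \<forall>r\<in>set_pmf (seed A).
           \<forall>m\<in>set_pmf (memory_after A r (take i es)). length m \<le> s))"

end

theory Submission imports Defs begin

text \<open>
  Reduction from the one-way communication problem INDEX. Put \<open>k = \<beta> + 2\<close>. Each bit of Alice's
  string owns a block of \<open>t + 1\<close> vertices, where \<open>t\<close> depends on \<open>\<beta>\<close> only; she turns the block into
  a star if the bit is set and leaves it without edges otherwise. Bob, who wants to learn bit \<open>j\<close>,
  joins a hub to all vertices outside the gadget except the leaves of block \<open>j\<close>. If the bit is set,
  then \<open>k + 1\<close> vertices dominate; otherwise \<open>t\<close> vertices are isolated, and \<open>t\<close> exceeds \<open>k + 1\<close> by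
  more than the square of the approximation factor. A complete bipartite gadget with sides of size
  \<open>k\<close> and more than \<open>k ^ 3\<close>, one of whose left vertices is the hub, makes the arboricity exactly
  \<open>k\<close>: the edges split into \<open>k\<close> star forests, whereas with fewer than \<open>k\<close> forests two right vertices
  would send equally coloured edges to the same two left vertices and close a 4-cycle.
\<close>

section \<open>The communication lower bound for INDEX\<close>

text \<open>The convex function \<open>exp\<close> lies below its chord from 0 to
  \<open>ln 3\<close>. For two probabilities with sum 1, adding the bounds gives 3^p + 3^(1-p) <=
  4.\<close>

lemma three_powr_le:
  fixes a :: real
  assumes "0 \<le> a" "a \<le> 1"
  shows "3 powr a \<le> 1 + 2 * a"
proof -
  have "exp ((1 - a) *\<^sub>R 0 + a *\<^sub>R ln 3) \<le> (1 - a) * exp 0 + a * exp (ln (3::real))"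
    using assms by (intro convex_onD[OF exp_convex]) auto
  then show ?thesis
    by (simp add: powr_def algebra_simps)
qed

text \<open>
  Let \<open>S\<close> be the sum over all \<open>j\<close> of the probability that bit \<open>j\<close> is decoded correctly from the message.
  By assumption \<open>S\<close> has mean at least \<open>3N/4\<close>, so \<open>3 ^ (S - 3N/4)\<close> has mean at least 1. For a fixed
  message, summing \<open>3 ^ S\<close> over all inputs gives a product with factors at most 4. Hence
  \<open>2 ^ N * 3 ^ (3N/4) \<le> card M * 4 ^ N\<close>.
\<close>

theorem index_lower_bound:
  fixes seed :: "'r pmf"
    and encode :: "'r \<Rightarrow> nat set \<Rightarrow> 'm pmf"
    and decode :: "'r \<Rightarrow> nat \<Rightarrow> 'm \<Rightarrow> bool pmf"
  assumes fin: "finite M"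
    and msg: "\<And>r X. r \<in> set_pmf seed \<Longrightarrow> X \<subseteq> {..<N} \<Longrightarrow> set_pmf (encode r X) \<subseteq> M"
    and succ: "\<And>X j. X \<subseteq> {..<N} \<Longrightarrow> j < N \<Longrightarrow>
      3 / 4 \<le> pmf (bind_pmf seed (\<lambda>r. bind_pmf (encode r X) (decode r j))) (j \<in> X)"
  shows "2 ^ N \<le> card M ^ 8"
proof -
  define p where "p r m j X = pmf (decode r j m) (j \<in> X)" for r m j X
  define q where "q r j X = pmf (bind_pmf (encode r X) (decode r j)) (j \<in> X)" for r j X
  define f where "f r m X = 3 powr ((\<Sum>j<N. p r m j X) - 3 * real N / 4)" for r m X
  define D :: real where "D = 3 powr (- (3 * real N / 4))"
  have f_sum: "(\<Sum>X\<in>Pow {..<N}. f r m X) \<le> 4 ^ N * D" for r m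
  proof -
    let ?T = "\<lambda>j. 3 powr pmf (decode r j m) True" and ?F = "\<lambda>j. 3 powr pmf (decode r j m) False"
    \<comment> \<open>Each factor depends only on whether \<open>j\<close> lies in \<open>X\<close>,
      so this is \<open>D\<close> times one term in the expansion of the product of all
      \<open>?T j + ?F j\<close>.\<close>
    have "f r m X = D * ((\<Prod>j\<in>X. ?T j) * (\<Prod>j\<in>{..<N} - X. ?F j))" if "X \<in> Pow {..<N}" for X
    proof -
      have "f r m X = D * (\<Prod>j<N. 3 powr p r m j X)"
        by (simp add: f_def D_def flip: powr_sum powr_add)
      also have "(\<Prod>j<N. 3 powr p r m j X) =
          (\<Prod>j\<in>{..<N} - X. 3 powr p r m j X) * (\<Prod>j\<in>X. 3 powr p r m j X)"
        using that by (intro prod.subset_diff) auto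
      also have "(\<Prod>j\<in>{..<N} - X. 3 powr p r m j X) = (\<Prod>j\<in>{..<N} - X. ?F j)"
        by (intro prod.cong) (auto simp: p_def)
      also have "(\<Prod>j\<in>X. 3 powr p r m j X) = (\<Prod>j\<in>X. ?T j)"
        by (intro prod.cong) (auto simp: p_def)
      finally show ?thesis by (simp add: mult_ac)
    qed
    then have "(\<Sum>X\<in>Pow {..<N}. f r m X) = D * (\<Prod>j<N. ?T j + ?F j)"
      by (simp add: prod_add sum_distrib_left)
    also have "(\<Prod>j<N. ?T j + ?F j) \<le> (\<Prod>j<N. 4)"
    proof (intro prod_mono conjI)
      fix j
      have "pmf (decode r j m) True + pmf (decode r j m) False = 1"
        using sum_pmf_eq_1[OF finite subset_UNIV, of "decode r j m"] by (simp add: UNIV_bool)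
      then show "?T j + ?F j \<le> 4"
        using three_powr_le[OF pmf_nonneg pmf_le_1, of "decode r j m" True]
          three_powr_le[OF pmf_nonneg pmf_le_1, of "decode r j m" False] by linarith
    qed simp
    finally show ?thesis by (simp add: D_def mult.commute mult_left_mono)
  qed
  \<comment> \<open>The tangent of 3^x at 0 is affine in the success probabilities, so it can be
    averaged over messages here and over seeds later.\<close>
  have f_ge: "1 + ln 3 * ((\<Sum>j<N. q r j X) - 3 * real N / 4) \<le> (\<Sum>m\<in>M. f r m X)"
    if r: "r \<in> set_pmf seed" and X: "X \<subseteq> {..<N}" for r X
  proof -
    note E = msg[OF r X]
    let ?e = "pmf (encode r X)"
    have one: "(\<Sum>m\<in>M. ?e m) = 1"
      using fin E by (rule sum_pmf_eq_1)
    have q: "q r j X = (\<Sum>m\<in>M. ?e m * p r m j X)" for j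
      unfolding q_def pmf_bind p_def using E fin
      by (subst integral_measure_pmf[of M]) auto
    have "1 + ln 3 * ((\<Sum>j<N. q r j X) - 3 * real N / 4) =
        (\<Sum>m\<in>M. ?e m * (1 + ln 3 * ((\<Sum>j<N. p r m j X) - 3 * real N / 4)))"
    proof -
      have "(\<Sum>j<N. q r j X) = (\<Sum>m\<in>M. ?e m * (\<Sum>j<N. p r m j X))"
        unfolding q sum_distrib_left by (rule sum.swap)
      moreover have "(\<Sum>m\<in>M. ?e m * (1 + ln 3 * ((\<Sum>j<N. p r m j X) - 3 * real N / 4))) =
        (\<Sum>m\<in>M. ?e m) + ln 3 * ((\<Sum>m\<in>M. ?e m * (\<Sum>j<N. p r m j X)) - 3 * real N / 4 * (\<Sum>m\<in>M. ?e m))"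
        by (simp add: sum_distrib_left sum.distrib sum_subtractf algebra_simps)
      ultimately show ?thesis by (simp add: one)
    qed
    also have "\<dots> \<le> (\<Sum>m\<in>M. ?e m * f r m X)"
    proof (intro sum_mono mult_left_mono pmf_nonneg)
      fix m
      show "1 + ln 3 * ((\<Sum>j<N. p r m j X) - 3 * real N / 4) \<le> f r m X"
        using exp_ge_add_one_self[of "((\<Sum>j<N. p r m j X) - 3 * real N / 4) * ln 3"]
        by (simp add: f_def powr_def mult.commute)
    qed
    \<comment> \<open>Without the weights the bound no longer depends on \<open>encode\<close>; this
      costs the factor \<open>card M\<close>.\<close>
    also have "\<dots> \<le> (\<Sum>m\<in>M. f r m X)"
      by (intro sum_mono mult_left_le_one_le) (auto simp: f_def pmf_le_1)
    finally show ?thesis .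
  qed
  define h where "h r = (\<Sum>X\<in>Pow {..<N}. 1 + ln 3 * ((\<Sum>j<N. q r j X) - 3 * real N / 4))" for r
  have h_le: "h r \<le> real (card M) * (4 ^ N * D)" if "r \<in> set_pmf seed" for r
  proof -
    have "h r \<le> (\<Sum>X\<in>Pow {..<N}. \<Sum>m\<in>M. f r m X)"
      unfolding h_def by (intro sum_mono f_ge that) auto
    also have "\<dots> = (\<Sum>m\<in>M. \<Sum>X\<in>Pow {..<N}. f r m X)"
      by (rule sum.swap)
    also have "\<dots> \<le> real (card M) * (4 ^ N * D)"
      by (rule sum_bounded_above) (rule f_sum)
    finally show ?thesis .
  qed
  have int_q [simp]: "integrable seed (\<lambda>r. q r j X)" for j X
    by (rule measure_pmf.integrable_const_bound[where B = 1]) (auto simp: q_def pmf_le_1)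
  have int_h: "integrable seed h"
    unfolding h_def by simp
  have "2 ^ N = (\<Sum>X\<in>Pow {..<N}. 1 :: real)"
    by (simp add: card_Pow)
  also have "\<dots> \<le> (\<Sum>X\<in>Pow {..<N}. 1 + ln 3 * ((\<Sum>j<N. \<integral>r. q r j X \<partial>seed) - 3 * real N / 4))"
  proof (intro sum_mono)
    fix X assume "X \<in> Pow {..<N}"
    then have "3 / 4 \<le> (\<integral>r. q r j X \<partial>seed)" if "j < N" for j
      using succ[of X j] that by (simp add: pmf_bind[of seed] q_def)
    then have "(\<Sum>j<N. 3 / 4) \<le> (\<Sum>j<N. \<integral>r. q r j X \<partial>seed)"
      by (intro sum_mono) auto
    then show "1 \<le> 1 + ln 3 * ((\<Sum>j<N. \<integral>r. q r j X \<partial>seed) - 3 * real N / 4)"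
      by (simp add: mult.commute)
  qed
  also have "\<dots> = (\<integral>r. h r \<partial>seed)"
    unfolding h_def by (simp add: Bochner_Integration.integral_sum)
  also have "\<dots> \<le> real (card M) * (4 ^ N * D)"
    using h_le by (intro measure_pmf.integral_le_const int_h) (auto simp: AE_measure_pmf_iff)
  finally have "2 ^ N * 3 powr (3 * real N / 4) \<le> real (card M) * 4 ^ N"
    by (simp add: D_def powr_minus field_simps)
  moreover have "(4::real) ^ N = 2 ^ N * 2 ^ N"
    by (simp flip: power_mult_distrib)
  ultimately have "2 ^ N * 3 powr (3 * real N / 4) \<le> 2 ^ N * (real (card M) * 2 ^ N)"
    by (simp only: mult.left_commute)
  then have "3 powr (3 * real N / 4) \<le> real (card M) * 2 ^ N"
    by (rule mult_left_le_imp_le) simp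
  \<comment> \<open>The eighth power clears the exponent 3/4 and leaves 3^6 = 729 against 2^9 = 512
    per bit; eight of the nine factors 2 cancel.\<close>
  then have "(3 powr (3 * real N / 4)) ^ 8 \<le> (real (card M) * 2 ^ N) ^ 8"
    by (intro power_mono) auto
  moreover have "(3 powr (3 * real N / 4)) ^ 8 = (729 :: real) ^ N"
  proof -
    have "(3 powr (3 * real N / 4)) ^ 8 = 3 powr (real (6 * N))"
      by (simp add: powr_powr flip: powr_realpow)
    also have "\<dots> = 3 ^ (6 * N)"
      by (rule powr_realpow) simp
    finally show ?thesis by (simp add: power_mult)
  qed
  moreover have "(512 :: real) ^ N \<le> 729 ^ N"
    by (intro power_mono) auto
  moreover have "(512 :: real) ^ N = 2 ^ N * (2 ^ N) ^ 8"
  proof -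
    have "(512 :: real) ^ N = (2 * 2 ^ 8) ^ N"
      by simp
    also have "\<dots> = 2 ^ N * (2 ^ N) ^ 8"
      by (simp only: power_mult_distrib power_mult[symmetric] mult.commute)
    finally show ?thesis .
  qed
  ultimately have "2 ^ N * (2 ^ N) ^ 8 \<le> real (card M) ^ 8 * (2 ^ N) ^ 8"
    by (simp only: power_mult_distrib)
  then have "2 ^ N \<le> real (card M) ^ 8"
    by simp
  then show ?thesis
    by (metis of_nat_le_iff of_nat_numeral of_nat_power)
qed

lemma card_bool_lists_less: "card {m :: bool list. length m \<le> s} < 2 ^ Suc s"
proof -
  have "card {m :: bool list. set m \<subseteq> UNIV \<and> length m \<le> s} = (\<Sum>i\<le>s. 2 ^ i)"
    by (subst card_lists_length_le) auto
  also have "\<dots> < 2 ^ Suc s"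
    by (induction s) auto
  finally show ?thesis by simp
qed

section \<open>Forests and arboricity\<close>

lemma forest_subset: "forest F \<Longrightarrow> G \<subseteq> F \<Longrightarrow> forest G"
  unfolding forest_def is_cycle_def by blast

text \<open>\<open>S a v\<close> says that \<open>v\<close> is a leaf of the star centred at
  \<open>a\<close>. A leaf has only its centre as neighbour, whereas a vertex on a cycle has two
  distinct ones.\<close>

lemma star_forest:
  assumes edge: "\<And>e. e \<in> F \<Longrightarrow> \<exists>a v. e = {a, v} \<and> S a v"
    and unique: "\<And>a b v. S a v \<Longrightarrow> S b v \<Longrightarrow> a = b"
    and leaf: "\<And>a b v. S a v \<Longrightarrow> \<not> S b a"
  shows "forest F"
  unfolding forest_def
proof
  assume "\<exists>vs. is_cycle F vs"
  then obtain vs where len: "3 \<le> length vs" and dist: "distinct vs"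
    and cyc: "\<And>i. i < length vs \<Longrightarrow> {vs ! i, vs ! (Suc i mod length vs)} \<in> F"
    by (auto simp: is_cycle_def)
  define l where "l = length vs"
  \<comment> \<open>Both cyclic neighbours of a leaf at position \<open>j\<close> would equal
    \<open>a\<close>, but the positions \<open>i\<close> and \<open>k\<close> differ because the
    length is at least 3.\<close>
  have no_leaf: False if i: "i < l" and S: "S a (vs ! (Suc i mod l))" for a i
  proof -
    define j k where "j = Suc i mod l" and "k = Suc j mod l"
    have jk: "j < l" "k < l" "i \<noteq> k"
      using len i by (auto simp: j_def k_def l_def mod_Suc)
    have *: "b = a" if b: "{b, vs ! j} \<in> F" for b
    proof -
      obtain x y where "{b, vs ! j} = {x, y}" "S x y"
        using edge[OF b] by blast
      then show ?thesis
        using S unique[of x y a] leaf[of x y a] by (auto simp: doubleton_eq_iff j_def)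
    qed
    have "vs ! i = a" "vs ! k = a"
      using cyc[of i] cyc[of j] i jk *[of "vs ! i"] *[of "vs ! k"]
      by (auto simp: j_def k_def l_def insert_commute)
    then show False
      using dist jk i by (auto simp: l_def nth_eq_iff_index_eq)
  qed
  \<comment> \<open>\<open>no_leaf\<close> addresses a vertex through its predecessor, so position 0
    is reached from \<open>l - 1\<close>.\<close>
  have "Suc (l - 1) = l"
    using len by (simp add: l_def)
  then have "0 < l" "1 < l" "Suc (l - 1) mod l = 0" "Suc 0 mod l = 1"
    using len by (auto simp: l_def)
  moreover have "{vs ! 0, vs ! 1} \<in> F"
    using cyc[of 0] \<open>0 < l\<close> \<open>Suc 0 mod l = 1\<close> by (simp add: l_def)
  then obtain a v where "{vs ! 0, vs ! 1} = {a, v}" "S a v"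
    using edge by blast
  ultimately show False
    using no_leaf[of 0 a] no_leaf[of "l - 1" a] by (auto simp: doubleton_eq_iff)
qed

text \<open>The cover may overlap, so each edge goes to the first forest containing it, and empty
  classes are dropped. Since a forest partition thus exists, the \<open>LEAST\<close> in
  \<open>arboricity\<close> is attained.\<close>

lemma arboricity_forest_cover:
  assumes E: "E \<subseteq> (\<Union>i<k. F i)" and F: "\<And>i. i < k \<Longrightarrow> forest (F i)"
  shows "arboricity E \<le> k"
    and "\<exists>P. partition_on E P \<and> finite P \<and> card P = arboricity E \<and> (\<forall>F\<in>P. forest F)"
proof -
  let ?Q = "\<lambda>k. \<exists>P. partition_on E P \<and> finite P \<and> card P = k \<and> (\<forall>F\<in>P. forest F)"
  define col where "col e = (LEAST i. i < k \<and> e \<in> F i)" for e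
  have col: "col e < k \<and> e \<in> F (col e)" if "e \<in> E" for e
    unfolding col_def using E that by (intro LeastI_ex[of "\<lambda>i. i < k \<and> e \<in> F i"]) auto
  define P where "P = (\<lambda>i. {e \<in> E. col e = i}) ` {..<k} - {{}}"
  have "partition_on E P"
    using col by (intro partition_onI) (auto simp: P_def disjnt_def)
  moreover have "\<forall>G\<in>P. forest G"
  proof
    fix G assume "G \<in> P"
    then obtain i where "i < k" "G = {e \<in> E. col e = i}"
      by (auto simp: P_def)
    then show "forest G"
      using col by (intro forest_subset[OF F[of i]]) auto
  qed
  moreover have "finite P"
    by (simp add: P_def)
  ultimately have Q: "?Q (card P)"
    by blast
  have "card P \<le> card ((\<lambda>i. {e \<in> E. col e = i}) ` {..<k})"
    unfolding P_def by (intro card_mono) auto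
  also have "\<dots> \<le> k"
    using card_image_le[of "{..<k}"] by fastforce
  finally show "arboricity E \<le> k"
    unfolding arboricity_def using Least_le[of ?Q, OF Q] by linarith
  show "?Q (arboricity E)"
    unfolding arboricity_def by (rule LeastI[of ?Q, OF Q])
qed

text \<open>Two pigeonholes: with fewer classes than left vertices, each right vertex has two edges
  in one class; at most \<open>card L ^ 3\<close> triples of two left vertices and a class exist, so
  two right vertices share one.\<close>

lemma complete_bipartite_forest_partition:
  assumes "finite L" "finite R" "L \<inter> R = {}"
    and card_R: "card L ^ 3 < card R"
    and edges: "\<And>u v. u \<in> L \<Longrightarrow> v \<in> R \<Longrightarrow> {u, v} \<in> E"
    and P: "partition_on E P" "finite P" "\<And>F. F \<in> P \<Longrightarrow> forest F"
  shows "card L \<le> card P"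
proof (rule ccontr)
  assume less: "\<not> card L \<le> card P"
  have part: "\<exists>F\<in>P. {u, v} \<in> F" if "u \<in> L" "v \<in> R" for u v
    using edges[OF that] partition_onD1[OF P(1)] by auto
  have "\<exists>z\<in>L \<times> L \<times> P. fst z \<noteq> fst (snd z) \<and>
      {fst z, v} \<in> snd (snd z) \<and> {fst (snd z), v} \<in> snd (snd z)" if v: "v \<in> R" for v
  proof -
    have "\<forall>u\<in>L. \<exists>F. F \<in> P \<and> {u, v} \<in> F"
      using part v by blast
    then obtain c where c: "\<And>u. u \<in> L \<Longrightarrow> c u \<in> P \<and> {u, v} \<in> c u"
      by (auto dest!: bchoice)
    then have "card (c ` L) \<le> card P"
      using P(2) by (intro card_mono) auto
    with less have "\<not> inj_on c L"
      by (intro pigeonhole) simp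
    then obtain u w where "u \<in> L" "w \<in> L" "u \<noteq> w" "c u = c w"
      by (auto simp: inj_on_def)
    then show ?thesis
      using c[of u] c[of w] by (intro bexI[of _ "(u, w, c u)"]) auto
  qed
  then obtain z where z: "\<And>v. v \<in> R \<Longrightarrow> z v \<in> L \<times> L \<times> P \<and> fst (z v) \<noteq> fst (snd (z v)) \<and>
      {fst (z v), v} \<in> snd (snd (z v)) \<and> {fst (snd (z v)), v} \<in> snd (snd (z v))"
    by metis
  have "card (z ` R) \<le> card (L \<times> L \<times> P)"
  proof (rule card_mono)
    show "z ` R \<subseteq> L \<times> L \<times> P"
      using z by blast
  qed (use assms in simp)
  also have "\<dots> \<le> card L ^ 3"
    using less by (simp add: card_cartesian_product power3_eq_cube)
  finally have "\<not> inj_on z R"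
    using card_R by (intro pigeonhole) simp
  then obtain v w where vw: "v \<in> R" "w \<in> R" "v \<noteq> w" "z v = z w"
    by (auto simp: inj_on_def)
  obtain a b F where abF: "z v = (a, b, F)"
    by (cases "z v") auto
  have F: "a \<in> L" "b \<in> L" "F \<in> P" "a \<noteq> b" "{a, v} \<in> F" "{v, b} \<in> F" "{w, a} \<in> F" "{b, w} \<in> F"
    using z[OF vw(1)] z[OF vw(2)] vw(4) abF by (auto simp: insert_commute)
  have "{[a, v, b, w] ! i, [a, v, b, w] ! (Suc i mod 4)} \<in> F" if i: "i < 4" for i
  proof -
    consider "i = 0" | "i = 1" | "i = 2" | "i = 3"
      using i by linarith
    then show ?thesis
      by cases (use F in simp_all)
  qed
  moreover have "distinct [a, v, b, w]"
    using F vw \<open>L \<inter> R = {}\<close> by auto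
  ultimately have "is_cycle F [a, v, b, w]"
    by (simp add: is_cycle_def)
  then show False
    using P(3)[OF \<open>F \<in> P\<close>] by (auto simp: forest_def)
qed

section \<open>Bounds on the domination number\<close>

lemma domination_number_le:
  assumes "finite V" "dominating_set V E S"
  shows "domination_number V E \<le> card S"
proof -
  have "finite {card S | S. dominating_set V E S}"
    by (rule finite_subset[of _ "card ` Pow V"]) (use assms in \<open>auto simp: dominating_set_def\<close>)
  then show ?thesis
    unfolding domination_number_def using assms by (intro Min_le) auto
qed

lemma domination_number_attained:
  assumes "finite V"
  obtains S where "dominating_set V E S" "card S = domination_number V E"
proof -
  have "finite {card S | S. dominating_set V E S}"
    by (rule finite_subset[of _ "card ` Pow V"]) (use assms in \<open>auto simp: dominating_set_def\<close>)
  moreover have "dominating_set V E V"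
    by (auto simp: dominating_set_def)
  ultimately have "domination_number V E \<in> {card S | S. dominating_set V E S}"
    unfolding domination_number_def by (intro Min_in) auto
  then show thesis
    using that by auto
qed

text \<open>An isolated vertex can only be dominated by belonging to the set itself.\<close>

lemma card_isolated_le_domination_number:
  assumes "finite V" "T \<subseteq> V" and "\<And>u v. v \<in> T \<Longrightarrow> {u, v} \<notin> E"
  shows "card T \<le> domination_number V E"
proof -
  obtain S where S: "dominating_set V E S" "card S = domination_number V E"
    using assms(1) by (rule domination_number_attained)
  then have "T \<subseteq> S" "finite S"
    using assms unfolding dominating_set_def by (blast, blast intro: finite_subset)
  then show ?thesis
    using S by (metis card_mono)
qed

section \<open>Cutting a streaming run in two\<close>

lemma fold_bind_pmf:
  "fold (\<lambda>e p. bind_pmf p (f e)) es p =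
     bind_pmf p (\<lambda>m. fold (\<lambda>e p. bind_pmf p (f e)) es (return_pmf m))"
proof (induction es arbitrary: p)
  case (Cons e es)
  show ?case
    by (simp add: Cons[of "bind_pmf p (f e)"] Cons[of "f e _"] bind_assoc_pmf bind_return_pmf)
qed (simp add: bind_return_pmf')

text \<open>The memory after \<open>es\<close> can serve as the message: for a fixed seed, the rest
  of the run depends on the prefix through \<open>m\<close> alone.\<close>

lemma memory_after_append:
  "memory_after A r (es @ es') = bind_pmf (memory_after A r es)
     (\<lambda>m. fold (\<lambda>e p. bind_pmf p (process_edge A r e)) es' (return_pmf m))"
  unfolding memory_after_def fold_append comp_def by (rule fold_bind_pmf)

section \<open>The graphs encoding INDEX and their parameters\<close>

text \<open>The gadget has sides \<open>{..<k}\<close> and \<open>{k..<B}\<close>; block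
  \<open>j\<close> has centre \<open>c j\<close> and leaves \<open>T j\<close>. \<open>B_gt\<close>
  gives the right side the more than \<open>k ^ 3\<close> vertices that the pigeonhole argument asks
  for.\<close>

locale index_reduction =
  fixes n k B N t :: nat and c :: "nat \<Rightarrow> nat" and T :: "nat \<Rightarrow> nat set"
  assumes k_ge: "2 \<le> k" and B_gt: "k + k ^ 3 < B" and B_le: "B \<le> n"
    and c_in: "j < N \<Longrightarrow> c j \<in> {B..<n}"
    and T_in: "j < N \<Longrightarrow> T j \<subseteq> {B..<n}"
    and card_T: "j < N \<Longrightarrow> card (T j) = t"
    and T_disjoint: "i < N \<Longrightarrow> j < N \<Longrightarrow> v \<in> T i \<Longrightarrow> v \<in> T j \<Longrightarrow> i = j"
    and c_notin_T: "i < N \<Longrightarrow> j < N \<Longrightarrow> c i \<notin> T j"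
begin

definition gadget :: "nat set set" where
  "gadget = {{i, v} | i v. i < k \<and> v \<in> {k..<B}}"

definition stars :: "nat set \<Rightarrow> nat set set" where
  "stars X = {{c j, v} | j v. j \<in> X \<and> v \<in> T j}"

definition hub :: "nat \<Rightarrow> nat set set" where
  "hub j = {{1, v} | v. v \<in> {B..<n} - T j}"

abbreviation instance_graph :: "nat set \<Rightarrow> nat \<Rightarrow> nat set set" where
  "instance_graph X j \<equiv> gadget \<union> stars X \<union> hub j"

lemma k_less_B: "k < B"
  using B_gt by simp

lemma simple_graph_instance:
  assumes "X \<subseteq> {..<N}" "j < N"
  shows "simple_graph {..<n} (instance_graph X j)"
proof -
  have "e \<subseteq> {..<n} \<and> card e = 2" if "e \<in> instance_graph X j" for e
    using that
  proof (elim UnE)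
    assume "e \<in> gadget"
    then show ?thesis
      using B_le by (auto simp: gadget_def)
  next
    assume "e \<in> stars X"
    then obtain i v where "e = {c i, v}" "i < N" "v \<in> T i"
      using assms by (auto simp: stars_def)
    moreover have "c i \<noteq> v"
      using c_notin_T[of i i] calculation by auto
    ultimately show ?thesis
      using c_in[of i] T_in[of i] by auto
  next
    assume "e \<in> hub j"
    then show ?thesis
      using k_ge k_less_B by (auto simp: hub_def)
  qed
  then show ?thesis
    by (simp add: simple_graph_def)
qed

lemma arboricity_instance:
  assumes X: "X \<subseteq> {..<N}" and j: "j < N"
  shows "arboricity (instance_graph X j) = k"
proof (rule antisym)
  \<comment> \<open>Forest \<open>i\<close> contains the gadget star at \<open>i\<close>. Forest 0
    also takes Alice's stars, which avoid the gadget; the hub edges enlarge the star at 1 in forest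
    1.\<close>
  define F where "F i = {{i, v} | v. v \<in> {k..<B}} \<union>
    (if i = 0 then stars X else if i = 1 then hub j else {})" for i
  have forest: "forest (F i)" if i: "i < k" for i
  proof (rule star_forest)
    let ?S = "\<lambda>a v. a = i \<and> v \<in> {k..<B} \<or> i = 0 \<and> (\<exists>j\<in>X. a = c j \<and> v \<in> T j) \<or>
      i = 1 \<and> a = 1 \<and> v \<in> {B..<n} - T j"
    have cX: "B \<le> c j" if "j \<in> X" for j
      using that X c_in[of j] by auto
    have cT: "c j \<notin> T i" if "i \<in> X" "j \<in> X" for i j
      using that X c_notin_T[of j i] by auto
    have TB: "\<not> v < B" if "j \<in> X" "v \<in> T j" for j v
      using that X T_in[of j] by fastforce
    have TX: "i = j" if "i \<in> X" "j \<in> X" "v \<in> T i" "v \<in> T j" for i j v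
      using that X T_disjoint[of i j v] by auto
    show "\<exists>a v. e = {a, v} \<and> ?S a v" if "e \<in> F i" for e
      using that by (auto simp: F_def stars_def hub_def split: if_splits)
    show "a = b" if "?S a v" "?S b v" for a b v
      using that by (auto dest: TX TB)
    show "\<not> ?S b a" if "?S a v" for a b v
      using that i k_less_B by (auto dest: cX cT TB)
  qed
  have "instance_graph X j \<subseteq> (\<Union>i<k. F i)"
  proof -
    have "gadget \<subseteq> (\<Union>i<k. F i)"
      by (auto simp: gadget_def F_def)
    moreover have "stars X \<subseteq> F 0" "hub j \<subseteq> F 1"
      by (auto simp: F_def)
    ultimately show ?thesis
      using k_ge by (auto 4 4)
  qed
  note le = arboricity_forest_cover[OF this forest]
  show "arboricity (instance_graph X j) \<le> k"
    by (rule le(1))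
  obtain P where P: "partition_on (instance_graph X j) P" "finite P"
      "card P = arboricity (instance_graph X j)" "\<And>F. F \<in> P \<Longrightarrow> forest F"
    using le(2) by auto
  have "card {..<k} \<le> card P"
    by (rule complete_bipartite_forest_partition[OF _ _ _ _ _ P(1,2,4), of _ "{k..<B}"])
      (use B_gt in \<open>auto simp: gadget_def\<close>)
  then show "k \<le> arboricity (instance_graph X j)"
    by (simp add: P(3))
qed

text \<open>The left side is taken whole, together with \<open>c j\<close>: vertex 0 covers the
  right side, \<open>c j\<close> its leaves, and the hub 1 all else.\<close>

lemma domination_number_member:
  assumes "j < N" "j \<in> X"
  shows "domination_number {..<n} (instance_graph X j) \<le> k + 1"
proof -
  have "dominating_set {..<n} (instance_graph X j) (insert (c j) {..<k})"
    unfolding dominating_set_def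
  proof (intro conjI ballI)
    show "insert (c j) {..<k} \<subseteq> {..<n}"
      using c_in[OF assms(1)] k_less_B B_le by auto
    fix v assume v: "v \<in> {..<n} - insert (c j) {..<k}"
    consider "v < B" | "v \<in> T j" | "B \<le> v" "v \<notin> T j"
      by (meson not_le)
    then show "\<exists>u\<in>insert (c j) {..<k}. {u, v} \<in> instance_graph X j"
    proof cases
      case 1
      then have "{0, v} \<in> gadget"
        using v k_ge unfolding gadget_def by force
      then show ?thesis
        using k_ge by force
    next
      case 2
      then show ?thesis
        using assms by (auto simp: stars_def)
    next
      case 3
      then have "{1, v} \<in> hub j"
        using v by (auto simp: hub_def)
      then show ?thesis
        using k_ge by force
    qed
  qed
  then have "domination_number {..<n} (instance_graph X j) \<le> card (insert (c j) {..<k})"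
    by (intro domination_number_le) auto
  also have "\<dots> \<le> k + 1"
    using card_insert_le_m1[of "k + 1" "{..<k}" "c j"] by simp
  finally show ?thesis .
qed

text \<open>With bit \<open>j\<close> unset, the leaves of block \<open>j\<close> are isolated: the
  hub skips them, and they are neither leaves nor centres of other stars.\<close>

lemma domination_number_nonmember:
  assumes "X \<subseteq> {..<N}" "j < N" "j \<notin> X"
  shows "t \<le> domination_number {..<n} (instance_graph X j)"
proof -
  have "{u, v} \<notin> instance_graph X j" if v: "v \<in> T j" for u v
  proof -
    have "B \<le> v"
      using v T_in[OF assms(2)] by auto
    then have "{u, v} \<notin> gadget" "{u, v} \<notin> hub j"
      using k_ge k_less_B v by (auto simp: gadget_def hub_def doubleton_eq_iff)
    moreover have "{u, v} \<notin> stars X"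
    proof
      assume "{u, v} \<in> stars X"
      then obtain i w where "{u, v} = {c i, w}" "i \<in> X" "w \<in> T i"
        by (auto simp: stars_def)
      then show False
        using v assms c_notin_T[of i j] T_disjoint[of i j v] by (auto simp: doubleton_eq_iff)
    qed
    ultimately show ?thesis by blast
  qed
  then have "card (T j) \<le> domination_number {..<n} (instance_graph X j)"
    using T_in[OF assms(2)] by (intro card_isolated_le_domination_number) auto
  then show ?thesis
    using assms card_T by simp
qed

text \<open>Alice's message is the memory after the gadget and her stars; Bob resumes the run with
  the hub edges and thresholds the estimate.\<close>

lemma space_lower_bound:
  assumes approx: "approximates_domination_number \<alpha> n k A"
    and space: "uses_space n k A s"
    and \<alpha>: "0 < \<alpha>" "\<alpha>\<^sup>2 * (k + 1) < t"
  shows "N \<le> 8 * Suc s"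
proof (cases "N = 0")
  case False
  \<comment> \<open>Fixed edge orders make Alice's part of the stream depend on \<open>X\<close>
    only and Bob's on \<open>j\<close> only.\<close>
  define edges where "edges E = (SOME es. set es = E \<and> distinct es)" for E :: "nat set set"
  have edges: "set (edges E) = E" "distinct (edges E)" if "finite E" for E
    using someI_ex[OF finite_distinct_list[OF that]] by (auto simp: edges_def)
  let ?pre = "\<lambda>X. edges (gadget \<union> stars X)"
  let ?es = "\<lambda>X j. ?pre X @ edges (hub j)"
  have set_es: "set (?es X j) = instance_graph X j" and stream: "graph_stream n k (?es X j)"
    if Xj: "X \<subseteq> {..<N}" "j < N" for X j
  proof -
    note G = simple_graph_instance[OF Xj]
    have "finite (instance_graph X j)"
      by (rule finite_subset[of _ "Pow {..<n}"]) (use G in \<open>auto simp: simple_graph_def\<close>)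
    then have fin: "finite (gadget \<union> stars X)" "finite (hub j)"
      by auto
    then show set_eq: "set (?es X j) = instance_graph X j"
      by (simp add: edges)
    \<comment> \<open>A stream may not repeat an edge. Vertex 1 lies in no star, and gadget edges
      stay below \<open>B\<close>.\<close>
    have "e \<notin> gadget \<and> e \<notin> stars X" if e: "e \<in> hub j" for e
    proof -
      obtain v where v: "e = {1, v}" "B \<le> v"
        using e by (auto simp: hub_def)
      have "1 \<notin> f" if f: "f \<in> stars X" for f
      proof -
        obtain i w where "f = {c i, w}" "i < N" "w \<in> T i"
          using f Xj by (auto simp: stars_def)
        then show ?thesis
          using c_in[of i] T_in[of i] k_ge k_less_B by auto
      qed
      then show ?thesis
        using v k_less_B by (auto simp: gadget_def doubleton_eq_iff)
    qed
    then have "distinct (?es X j)"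
      using fin by (auto simp: edges)
    then show "graph_stream n k (?es X j)"
      unfolding graph_stream_def set_eq using G arboricity_instance[OF Xj] by simp
  qed
  define encode where "encode r X = memory_after A r (?pre X)" for r X
  define decode where "decode = (\<lambda>r j m. map_pmf (\<lambda>y. y \<le> \<alpha> * real (k + 1))
    (bind_pmf (fold (\<lambda>e p. bind_pmf p (process_edge A r e)) (edges (hub j)) (return_pmf m))
      (estimate A r)))"
  have "2 ^ N \<le> card {m :: bool list. length m \<le> s} ^ 8"
  proof (rule index_lower_bound)
    show "finite {m :: bool list. length m \<le> s}"
      using finite_lists_length_le[of "UNIV :: bool set" s] by simp
  next
    fix r X assume r: "r \<in> set_pmf (seed A)" and X: "X \<subseteq> {..<N}"
    have "length m \<le> s" if "m \<in> set_pmf (encode r X)" for m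
    proof -
      \<comment> \<open>\<open>uses_space\<close> speaks of prefixes of admissible streams only, so
        Alice's part is completed by Bob's for index 0, which exists as \<open>N\<close> is
        nonzero.\<close>
      have "take (length (?pre X)) (?es X 0) = ?pre X" "length (?pre X) \<le> length (?es X 0)"
        by simp_all
      then show ?thesis
        using space stream[OF X, of 0] False r that unfolding uses_space_def encode_def
        by (metis gr0I)
    qed
    then show "set_pmf (encode r X) \<subseteq> {m. length m \<le> s}"
      by blast
  next
    fix X j assume Xj: "X \<subseteq> {..<N}" "j < N"
    let ?d = "real (domination_number {..<n} (instance_graph X j))"
    have decoded: "bind_pmf (seed A) (\<lambda>r. bind_pmf (encode r X) (decode r j)) =
        map_pmf (\<lambda>y. y \<le> \<alpha> * real (k + 1)) (output_distribution A (?es X j))"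
      by (simp add: encode_def decode_def output_distribution_def memory_after_append
          map_bind_pmf bind_assoc_pmf)
    have "3 / 4 \<le> measure_pmf.prob (output_distribution A (?es X j)) {y. within_factor \<alpha> ?d y}"
      using approx stream[OF Xj] set_es[OF Xj] unfolding approximates_domination_number_def by metis
    also have "\<dots> \<le> measure_pmf.prob (output_distribution A (?es X j))
        ((\<lambda>y. y \<le> \<alpha> * real (k + 1)) -` {j \<in> X})"
    proof (intro measure_pmf.finite_measure_mono subsetI)
      fix y assume "y \<in> {y. within_factor \<alpha> ?d y}"
      then have y: "?d / \<alpha> \<le> y" "y \<le> \<alpha> * ?d"
        by (auto simp: within_factor_def)
      \<comment> \<open>A set bit forces the estimate to at most \<alpha> (k + 1), an unset one to
        at least t / \<alpha>, which is larger.\<close>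
      have "y \<le> \<alpha> * real (k + 1) \<longleftrightarrow> j \<in> X"
      proof (cases "j \<in> X")
        case True
        then have "?d \<le> real (k + 1)"
          using domination_number_member[OF Xj(2)] by (simp only: of_nat_le_iff)
        then have "\<alpha> * ?d \<le> \<alpha> * real (k + 1)"
          using \<alpha> by (intro mult_left_mono) auto
        with y True show ?thesis
          by simp
      next
        case False
        then have "real t \<le> ?d"
          using domination_number_nonmember[OF Xj] by simp
        then have "\<alpha>\<^sup>2 * real (k + 1) < ?d"
          using \<alpha> by simp
        then have "\<alpha> * real (k + 1) < ?d / \<alpha>"
          using \<alpha> by (simp add: pos_less_divide_eq power2_eq_square mult_ac)
        with y False show ?thesis
          by simp
      qed
      then show "y \<in> (\<lambda>y. y \<le> \<alpha> * real (k + 1)) -` {j \<in> X}"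
        by simp
    qed simp
    finally show "3 / 4 \<le> pmf (bind_pmf (seed A) (\<lambda>r. bind_pmf (encode r X) (decode r j))) (j \<in> X)"
      unfolding decoded by (simp add: pmf_map)
  qed
  also have "\<dots> \<le> (2 ^ Suc s) ^ 8"
    by (rule power_mono[OF less_imp_le[OF card_bool_lists_less]]) simp
  finally have "(2::nat) ^ N \<le> 2 ^ (Suc s * 8)"
    by (simp only: power_mult)
  then show ?thesis
    by simp
qed simp

end

section \<open>Packing blocks and the linear bound\<close>

text \<open>Consecutive intervals of length \<open>Suc t\<close> are cut from \<open>B\<close>
  onwards, each with its first vertex as centre, as often as they fit below
  \<open>n\<close>.\<close>

lemma index_reduction_blocks:
  assumes "2 \<le> k" "k + k ^ 3 < B" "B \<le> n"
  shows "index_reduction n k B ((n - B) div Suc t) t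
    (\<lambda>j. B + j * Suc t) (\<lambda>j. {B + j * Suc t<..<B + Suc j * Suc t})"
proof
  have bound: "B + Suc j * Suc t \<le> n" if "j < (n - B) div Suc t" for j
  proof -
    have "Suc j * Suc t \<le> (n - B) div Suc t * Suc t"
      using that by (intro mult_le_mono1) simp
    also have "\<dots> \<le> n - B"
      by (rule div_times_less_eq_dividend)
    finally show ?thesis
      using assms by simp
  qed
  have sep: "B + Suc i * Suc t \<le> B + j * Suc t" if "i < j" for i j
    using that by (intro add_left_mono mult_le_mono1) simp
  fix i j v
  assume j: "j < (n - B) div Suc t"
  show "B + j * Suc t \<in> {B..<n}" "{B + j * Suc t<..<B + Suc j * Suc t} \<subseteq> {B..<n}"
    using bound[OF j] by auto
  show "card {B + j * Suc t<..<B + Suc j * Suc t} = t"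
    by simp
  assume "i < (n - B) div Suc t"
  show "B + i * Suc t \<notin> {B + j * Suc t<..<B + Suc j * Suc t}"
    using sep[of i j] sep[of j i] by (cases i j rule: linorder_cases) auto
  assume "v \<in> {B + i * Suc t<..<B + Suc i * Suc t}" "v \<in> {B + j * Suc t<..<B + Suc j * Suc t}"
  then show "i = j"
    using sep[of i j] sep[of j i] by (cases i j rule: linorder_cases) auto
qed (use assms in auto)

theorem theorem31:
  fixes \<beta> :: nat
    and A :: "nat \<Rightarrow> 'r streaming_algorithm"
    and space_bound :: "nat \<Rightarrow> nat"
  assumes "\<beta> \<ge> 1"
    and "\<And>n. approximates_domination_number (real \<beta> / 32) n (\<beta> + 2) (A n)"
    and "\<And>n. uses_space n (\<beta> + 2) (A n) (space_bound n)"
  shows "(\<lambda>n. real (space_bound n)) \<in> \<Omega>(\<lambda>n. real n)"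
proof -
  define k B t where "k = \<beta> + 2" and "B = k + k ^ 3 + 1" and "t = \<beta>\<^sup>2 * (k + 1)"
  \<comment> \<open>Of the nine copies of \<open>Suc t\<close>, eight come from \<open>Suc\<close>
    in the space bound and one from rounding in the block count.\<close>
  define C where "C = B + 9 * Suc t"
  have t: "(real \<beta> / 32)\<^sup>2 * (k + 1) < t"
  proof -
    have "(real \<beta> / 32)\<^sup>2 < (real \<beta>)\<^sup>2"
      using assms(1) by (simp add: power_divide)
    then have "(real \<beta> / 32)\<^sup>2 * real (k + 1) < (real \<beta>)\<^sup>2 * real (k + 1)"
      by (rule mult_strict_right_mono) simp
    then show ?thesis
      by (simp only: t_def of_nat_mult of_nat_power)
  qed
  have n_le: "n \<le> C + 8 * Suc t * space_bound n" if "B \<le> n" for n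
  proof -
    interpret index_reduction n k B "(n - B) div Suc t" t
      "\<lambda>j. B + j * Suc t" "\<lambda>j. {B + j * Suc t<..<B + Suc j * Suc t}"
      using that by (intro index_reduction_blocks) (auto simp: k_def B_def)
    have "(n - B) div Suc t \<le> 8 * Suc (space_bound n)"
      using assms t by (intro space_lower_bound[of "real \<beta> / 32" "A n"]) (auto simp: k_def)
    moreover have "n - B < Suc ((n - B) div Suc t) * Suc t"
      by (metis dividend_less_div_times mult_Suc zero_less_Suc)
    ultimately have "n - B < Suc (8 * Suc (space_bound n)) * Suc t"
      by (meson Suc_le_mono less_le_trans mult_le_mono1)
    then show ?thesis
      by (simp add: C_def algebra_simps)
  qed
  \<comment> \<open>Once \<open>n\<close> is at least \<open>2 * C\<close>, the additive constant
    absorbs at most half of \<open>n\<close>, which doubles 8 to 16.\<close>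
  have "1 / (16 * real (Suc t)) * norm (real n) \<le> norm (real (space_bound n))" if "2 * C \<le> n" for n
  proof -
    have "B \<le> n"
      using that by (simp add: C_def)
    then have "real n \<le> real (C + 8 * Suc t * space_bound n)" "real (2 * C) \<le> real n"
      using n_le that by (auto simp only: of_nat_le_iff)
    then have "real n \<le> 16 * real (Suc t) * space_bound n"
      by (simp add: algebra_simps)
    then show ?thesis
      by (simp add: pos_divide_le_eq mult_ac)
  qed
  then have "\<forall>\<^sub>F n in at_top. 1 / (16 * real (Suc t)) * norm (real n) \<le> norm (real (space_bound n))"
    using eventually_ge_at_top[of "2 * C"] by (rule eventually_mono[rotated])
  then show ?thesis
    by (intro landau_omega.bigI[of "1 / (16 * real (Suc t))"]) auto
qed

end
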